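(* Let $0\le\alpha\le 1$ be fixed. Then there exist infinitely many integers $N\ge 1$ such that, with $n$ denoting the number of binary digits of $N$ (so that $N$ is an $n$-bit integer), $N$ is $Y^{1+o(1)}$-smooth, where $$ Y=\exp\left(2e^{-\gamma}(\log 2)^{\alpha/2}(\log N)^{1-\alpha/2}\left(\log\log\log N\right)^{-1}\right), $$ and $N$ has at most $$ \frac{1}{2\log 2}n^{\alpha}+O\left(n^{\alpha/2}\log n\right) $$ non-zero digits in its binary expansion.
   Context: A positive integer is called $y$-smooth if it has no prime divisor $p>y$. An $n$-bit integer is a positive integer whose binary expansion has exactly $n$ digits. $\gamma$ denotes the Euler–Mascheroni constant and $\log$ the natural logarithm. The quantity $o(1)$ tends to $0$ as $N\to\infty$ through the infinite set of integers whose existence is asserted. $U=O(V)$ means $|U|\le cV$ for some positive absolute constant $c$. *)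

theory Defs
  imports
    "HOL-Analysis.Analysis"
    "HOL-Computational_Algebra.Primes"
    "HOL-Library.Log_Nat"
begin

definition smooth :: "real \<Rightarrow> nat \<Rightarrow> bool" where
  "smooth y N \<longleftrightarrow> N > 0 \<and> \<not> (\<exists>p. prime p \<and> p dvd N \<and> real p > y)"

text \<open>For \<open>N > 0\<close> the number of digits of the binary expansion of \<open>N\<close> is \<open>floorlog 2 N\<close>.\<close>

definition binary_length :: "nat \<Rightarrow> nat" where
  "binary_length N = floorlog 2 N"

definition nonzero_digits :: "nat \<Rightarrow> nat" where
  "nonzero_digits N = card {i. (N div 2 ^ i) mod 2 \<noteq> 0}"

text \<open>
  \<open>ln (ln (ln N))\<close> is positive precisely for \<open>N \<ge> 16\<close>; the values at smaller \<open>N\<close>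
  carry no meaning and are never relevant in asymptotic statements.
\<close>

definition smoothness_level :: "real \<Rightarrow> nat \<Rightarrow> real" where
  "smoothness_level \<alpha> N =
     exp (2 * exp (- euler_mascheroni) * ln 2 powr (\<alpha> / 2) * ln (real N) powr (1 - \<alpha> / 2)
          * inverse (ln (ln (ln (real N)))))"

end

theory Submission
  imports Defs "HOL-Number_Theory.Number_Theory" "HOL-Real_Asymp.Real_Asymp"
begin

text \<open>
  The numbers are \<open>N = (2 ^ m + 1) ^ k\<close>, where \<open>m\<close> is the product of the odd primes up to \<open>x\<close>
  and \<open>k\<close> is \<open>m powr (\<alpha> / (2 - \<alpha>))\<close> rounded down. With \<open>n \<approx> m * k\<close> digits this means
  \<open>k \<approx> n powr (\<alpha> / 2)\<close> and \<open>m \<approx> n powr (1 - \<alpha> / 2)\<close>.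

  Few digits: by the binomial theorem \<open>N\<close> is a sum of shifted binomial coefficients, and addition does
  not increase the number of non-zero digits beyond the sum of the two counts. The bit lengths of
  the coefficients \<open>k choose j\<close> add up to at most \<open>k\<^sup>2 / (2 * ln 2) + O(k)\<close>
  (\<open>nonzero_digits_binomial_power\<close>), and \<open>k\<^sup>2 \<le> n powr \<alpha>\<close>.

  Smoothness: the prime factors of \<open>N\<close> divide \<open>2 ^ (2 * m) - 1\<close>, which is a product of
  cyclotomic values of size about \<open>2 ^ totient d\<close> with \<open>d\<close> dividing \<open>2 * m\<close>. So
  no prime factor exceeds \<open>2 ^ (totient (2 * m) * (1 + o(1)))\<close>
  (\<open>prime_divisor_two_power_minus_one_le\<close>), and
  \<open>totient (2 * m)\<close> is \<open>2 * m\<close> times the product of \<open>1 - 1 / p\<close> over all primes \<open>p \<le> x\<close>.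
  By Mertens this is about \<open>2 * m * exp (- euler_mascheroni) / ln x\<close>, and \<open>ln x\<close> is asymptotically
  the triple logarithm of \<open>N\<close>.

  Only infinitely many \<open>N\<close> are wanted, so an upper bound for the Mertens product along infinitely many
  \<open>x\<close> suffices (\<open>Mertens_product_infinitely_often\<close>). It follows from the pole of the zeta
  function at \<open>1\<close> together with the derivative of \<open>Gamma\<close> at \<open>1\<close>, in place of an asymptotic formula for
  the distribution of primes.
\<close>

section \<open>Non-zero binary digits of powers of \<open>2 ^ m + 1\<close>\<close>

text \<open>
  The digit count is a cardinality, which silently vanishes on infinite sets; this inclusion
  supplies the finiteness as well as the bound by the binary length.
\<close>

lemma digit_positions_subset:
  "{i. (N div 2 ^ i) mod 2 \<noteq> (0::nat)} \<subseteq> {..<binary_length N}"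
proof
  fix i assume "i \<in> {i. (N div 2 ^ i) mod 2 \<noteq> (0::nat)}"
  then have "2 ^ i \<le> N"
    by (intro leI notI) auto
  then have "i + 1 \<le> floorlog 2 N"
    by (intro floorlog_geI) simp_all
  then show "i \<in> {..<binary_length N}" by (simp add: binary_length_def)
qed

lemma nonzero_digits_le_binary_length: "nonzero_digits N \<le> binary_length N"
  unfolding nonzero_digits_def using card_mono[OF _ digit_positions_subset] by simp

lemma nonzero_digits_0 [simp]: "nonzero_digits 0 = 0"
  by (simp add: nonzero_digits_def)

lemma nonzero_digits_rec: "nonzero_digits N = N mod 2 + nonzero_digits (N div 2)"
proof -
  let ?D = "\<lambda>N. {i. (N div 2 ^ i) mod 2 \<noteq> (0::nat)}"
  have fin: "finite (?D M)" for M
    by (rule finite_subset[OF digit_positions_subset]) simp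
  have "?D N = (if N mod 2 = 0 then {} else {0}) \<union> Suc ` ?D (N div 2)"
  proof (rule Set.set_eqI)
    fix i show "i \<in> ?D N \<longleftrightarrow> i \<in> (if N mod 2 = 0 then {} else {0}) \<union> Suc ` ?D (N div 2)"
      by (cases i) (auto simp: div_mult2_eq image_iff)
  qed
  moreover have "card (Suc ` ?D (N div 2)) = card (?D (N div 2))"
    by (rule card_image) simp
  ultimately show ?thesis
    unfolding nonzero_digits_def using fin[of "N div 2"]
    by (subst card_Un_disjoint[symmetric] | auto)+
qed

lemma nonzero_digits_Suc: "nonzero_digits (Suc n) \<le> Suc (nonzero_digits n)"
proof (induction n rule: less_induct)
  case (less n)
  show ?case
  proof (cases "even n")
    case True
    then have "Suc n mod 2 = 1" "Suc n div 2 = n div 2" "n mod 2 = 0" by presburger+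
    then show ?thesis using nonzero_digits_rec[of "Suc n"] nonzero_digits_rec[of n] by simp
  next
    case False
    then have eq: "Suc n mod 2 = 0" "Suc n div 2 = Suc (n div 2)" "n mod 2 = 1" and lt: "n div 2 < n"
      by presburger+
    then show ?thesis
      using nonzero_digits_rec[of "Suc n"] nonzero_digits_rec[of n] less[OF lt] by simp
  qed
qed

text \<open>
  A carry replaces two digits \<open>1\<close> by a single one, so it never creates digits. The induction
  strips the last digit of both summands; if both are odd the carry is absorbed by
  \<open>nonzero_digits_Suc\<close>.
\<close>

lemma nonzero_digits_add: "nonzero_digits (a + b) \<le> nonzero_digits a + nonzero_digits b"
proof (induction a arbitrary: b rule: less_induct)
  case (less a)
  show ?case
  proof (cases "a = 0")
    case False
    then have lt: "a div 2 < a" by simp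
    note IH = less[OF lt, of "b div 2"]
    note rec = nonzero_digits_rec[of "a + b"] nonzero_digits_rec[of a] nonzero_digits_rec[of b]
    show ?thesis
    proof (cases "odd a \<and> odd b")
      case True
      then have "(a + b) mod 2 = 0" "(a + b) div 2 = Suc (a div 2 + b div 2)" "a mod 2 = 1" "b mod 2 = 1"
        by presburger+
      then show ?thesis using rec IH nonzero_digits_Suc[of "a div 2 + b div 2"] by simp
    next
      case False
      then have "(a + b) mod 2 = a mod 2 + b mod 2" "(a + b) div 2 = a div 2 + b div 2"
        by presburger+
      then show ?thesis using rec IH by simp
    qed
  qed simp
qed

lemma nonzero_digits_sum:
  "finite A \<Longrightarrow> nonzero_digits (\<Sum>x\<in>A. f x) \<le> (\<Sum>x\<in>A. nonzero_digits (f x))"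
proof (induction A rule: finite_induct)
  case (insert x A)
  then show ?case using nonzero_digits_add[of "f x" "\<Sum>x\<in>A. f x"] by simp
qed simp

lemma nonzero_digits_shift: "nonzero_digits (a * 2 ^ i) = nonzero_digits a"
proof (induction i)
  case (Suc i)
  have "nonzero_digits (a * 2 ^ Suc i) = nonzero_digits (a * 2 ^ i)"
    using nonzero_digits_rec[of "a * 2 ^ Suc i"] by (simp add: mult.assoc[symmetric])
  with Suc show ?case by simp
qed simp

lemma binary_length_bounds:
  assumes "N > 0"
  shows "2 ^ (binary_length N - 1) \<le> N" "N < 2 ^ binary_length N"
  using floorlog_bounds[of N 2] assms by (auto simp: binary_length_def)

lemma nonzero_digits_le_ln:
  assumes "N > 0"
  shows "real (nonzero_digits N) \<le> 1 + ln (real N) / ln 2"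
proof -
  have "2 ^ (binary_length N - 1) \<le> real N"
    using binary_length_bounds(1)[OF assms] by (metis of_nat_le_iff of_nat_numeral of_nat_power)
  then have "ln (2 ^ (binary_length N - 1)) \<le> ln (real N)"
    using assms by simp
  then have "real (binary_length N - 1) \<le> ln (real N) / ln 2"
    by (simp add: ln_realpow field_simps)
  then show ?thesis using nonzero_digits_le_binary_length[of N] by linarith
qed

text \<open>
  Passing from row \<open>k\<close> of Pascal's triangle to row \<open>k + 1\<close> multiplies the product of the
  entries by \<open>(k + 1) ^ (k + 1) / fact (k + 1)\<close>, which is one term of the series of
  \<open>exp (k + 1)\<close>. Thus each row adds at most its index to the logarithm. The resulting
  \<open>k\<^sup>2 / 2\<close>, divided by \<open>ln 2\<close> when logarithms become bit lengths, is the origin of the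
  constant \<open>1 / (2 * ln 2)\<close>.
\<close>

lemma ln_prod_binomial_le:
  "(\<Sum>j\<le>k. ln (real (k choose j))) \<le> real k * (real k + 1) / 2"
proof (induction k)
  case (Suc k)
  have step: "ln (real (Suc k choose j)) = ln (real (k choose j)) + (ln (real (Suc k)) - ln (real (Suc k - j)))"
    if "j \<le> k" for j
  proof -
    have "(Suc k - j) * (Suc k choose j) = Suc k * (k choose j)"
      using binomial_absorb_comp[of "Suc k" j] by simp
    then have "real (Suc k - j) * real (Suc k choose j) = real (Suc k) * real (k choose j)"
      by (metis of_nat_mult)
    then have "ln (real (Suc k - j)) + ln (real (Suc k choose j)) = ln (real (Suc k)) + ln (real (k choose j))"
      using that by (subst (1 2) ln_mult_pos[symmetric]) auto
    then show ?thesis by simp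
  qed
  have fact: "(\<Sum>j\<le>k. ln (real (Suc k - j))) = ln (fact (Suc k))"
  proof -
    have "(\<Sum>j\<le>k. ln (real (Suc k - j))) = (\<Sum>j\<le>k. ln (real (Suc j)))"
      by (rule sum.reindex_bij_witness[of _ "\<lambda>j. k - j" "\<lambda>j. k - j"]) (auto simp: Suc_diff_le)
    also have "\<dots> = ln (fact (Suc k))"
    proof (induction k)
      case (Suc k)
      have "fact (Suc (Suc k)) = real (Suc (Suc k)) * fact (Suc k)" by simp
      then show ?case using Suc by (simp add: ln_mult_pos del: fact_Suc of_nat_Suc)
    qed simp
    finally show ?thesis .
  qed
  have "real (Suc k) ^ Suc k / fact (Suc k) \<le> exp (real (Suc k))"
  proof -
    \<comment> \<open>Compare one term with the whole exponential series.\<close>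
    have "(\<Sum>n\<in>{Suc k}. inverse (fact n) * real (Suc k) ^ n) \<le> (\<Sum>n. inverse (fact n) * real (Suc k) ^ n)"
      by (intro sum_le_suminf summable_exp) auto
    then show ?thesis by (simp add: exp_def scaleR_conv_of_real divide_inverse_commute del: fact_Suc of_nat_Suc power_Suc)
  qed
  moreover have "real (Suc k) ^ Suc k / fact (Suc k) > 0"
    by (intro divide_pos_pos zero_less_power) (auto simp del: fact_Suc)
  ultimately have "ln (real (Suc k) ^ Suc k / fact (Suc k)) \<le> real (Suc k)"
    using ln_mono[of _ "exp (real (Suc k))"] by (simp del: fact_Suc of_nat_Suc power_Suc)
  then have st: "real (Suc k) * ln (real (Suc k)) - ln (fact (Suc k)) \<le> real (Suc k)"
    by (subst (asm) ln_divide_pos) (auto simp: ln_realpow simp del: fact_Suc of_nat_Suc power_Suc)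
  have "(\<Sum>j\<le>Suc k. ln (real (Suc k choose j))) = (\<Sum>j\<le>k. ln (real (Suc k choose j)))"
    by simp
  also have "\<dots> = (\<Sum>j\<le>k. ln (real (k choose j))) + (real (Suc k) * ln (real (Suc k)) - ln (fact (Suc k)))"
    by (simp add: step fact[symmetric] sum.distrib sum_subtractf del: of_nat_Suc fact_Suc of_nat_diff)
  also have "\<dots> \<le> real k * (real k + 1) / 2 + real (Suc k)"
    using Suc st by simp
  also have "\<dots> = real (Suc k) * (real (Suc k) + 1) / 2"
    by (simp add: field_simps)
  finally show ?case .
qed simp

text \<open>
  In the binomial expansion each coefficient is merely shifted, so the digits can be counted
  coefficient by coefficient, independently of \<open>m\<close>.
\<close>

lemma nonzero_digits_binomial_power:
  "real (nonzero_digits ((2 ^ m + 1) ^ k)) \<le> real k ^ 2 / (2 * ln 2) + 3 * real k + 1"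
proof -
  have "(2 ^ m + 1) ^ k = (\<Sum>j\<le>k. (k choose j) * 2 ^ (m * j) :: nat)"
    using binomial[of "2 ^ m" 1 k] by (simp add: power_mult)
  then have "nonzero_digits ((2 ^ m + 1) ^ k) \<le> (\<Sum>j\<le>k. nonzero_digits (k choose j))"
    using nonzero_digits_sum[of "{..k}" "\<lambda>j. (k choose j) * 2 ^ (m * j)"]
    by (simp add: nonzero_digits_shift)
  then have "real (nonzero_digits ((2 ^ m + 1) ^ k)) \<le> (\<Sum>j\<le>k. real (nonzero_digits (k choose j)))"
    by (metis of_nat_le_iff of_nat_sum)
  also have "\<dots> \<le> (\<Sum>j\<le>k. 1 + ln (real (k choose j)) / ln 2)"
    by (intro sum_mono nonzero_digits_le_ln) auto
  also have "\<dots> = real k + 1 + (\<Sum>j\<le>k. ln (real (k choose j))) / ln 2"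
    by (simp add: sum.distrib sum_divide_distrib)
  also have "\<dots> \<le> real k + 1 + (real k * (real k + 1) / 2) / ln 2"
    by (intro add_left_mono divide_right_mono ln_prod_binomial_le) auto
  also have "\<dots> = real k ^ 2 / (2 * ln 2) + (1 + real k + real k / (2 * ln 2))"
    by (simp add: field_simps power2_eq_square)
  also have "real k / (2 * ln 2) \<le> 2 * real k"
  proof -
    have "ln 2 \<ge> (1 / 2 :: real)"
      using ln_le_minus_one[of "1 / 2 :: real"] by (simp add: ln_div)
    then have "1 / (2 * ln 2) \<le> (2::real)" by (simp add: field_simps)
    from mult_left_mono[OF this, of "real k"] show ?thesis by simp
  qed
  finally show ?thesis by simp
qed

section \<open>Prime divisors of \<open>2 ^ M - 1\<close>\<close>

text \<open>
  The Euclidean algorithm on the exponents is mirrored on the numbers, because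
  \<open>2 ^ m\<close> and \<open>2 ^ (m mod n)\<close> agree modulo \<open>2 ^ n - 1\<close>.
\<close>

lemma gcd_two_power_minus_one:
  "gcd (2 ^ a - 1) (2 ^ b - 1 :: nat) = 2 ^ gcd a b - 1"
proof (induction a b rule: gcd_nat_induct)
  case (base m)
  then show ?case by simp
next
  case (step m n)
  have "[2 ^ n = 1] (mod (2 ^ n - 1 :: nat))"
    by (simp add: cong_altdef_nat)
  then have "[(2 ^ n) ^ (m div n) * 2 ^ (m mod n) = 1 ^ (m div n) * 2 ^ (m mod n)] (mod (2 ^ n - 1 :: nat))"
    by (intro cong_mult cong_pow cong_refl)
  then have "[2 ^ m = 2 ^ (m mod n)] (mod (2 ^ n - 1 :: nat))"
    by (simp flip: power_mult power_add)
  then have "[2 ^ m - 1 = 2 ^ (m mod n) - 1] (mod (2 ^ n - 1 :: nat))"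
    by (intro cong_diff_nat) auto
  then have "gcd (2 ^ m - 1) (2 ^ n - 1 :: nat) = gcd (2 ^ (m mod n) - 1) (2 ^ n - 1)"
    by (rule cong_gcd_eq)
  also have "\<dots> = 2 ^ gcd n (m mod n) - 1"
    using step by (simp add: gcd.commute)
  finally show ?case by (simp add: gcd_red_nat[symmetric])
qed

lemma two_power_minus_one_dvd:
  assumes "a dvd b"
  shows "2 ^ a - 1 dvd (2 ^ b - 1 :: nat)"
proof -
  have "gcd a b = a" using assms by (rule gcd_proj1_if_dvd_nat)
  then have "2 ^ a - 1 = gcd (2 ^ a - 1) (2 ^ b - 1 :: nat)"
    unfolding gcd_two_power_minus_one by (simp only:)
  then show ?thesis by (metis gcd_dvd2)
qed

lemma gcd_Lcm_finite:
  fixes a :: nat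
  assumes "finite S"
  shows "gcd a (Lcm S) = Lcm (gcd a ` S)"
  using assms by (induction S rule: finite_induct) (simp_all add: gcd_lcm_distrib)

text \<open>
  If \<open>Q\<close> is the set of all prime divisors of \<open>d\<close>, this is the value at \<open>2\<close> of the \<open>d\<close>-th
  cyclotomic polynomial: by inclusion-exclusion the least common multiple collects the
  contributions of all proper divisors of \<open>d\<close>. Keeping \<open>Q\<close> as a parameter permits an induction
  that adds one prime at a time, with no polynomials involved.
\<close>

definition cyclotomic_at_2 :: "nat \<Rightarrow> nat set \<Rightarrow> real" where
  "cyclotomic_at_2 d Q = real (2 ^ d - 1) / real (Lcm ((\<lambda>q. 2 ^ (d div q) - 1) ` Q))"

lemma Lcm_two_power_pos:
  assumes "finite Q" "d > 0" "\<And>q. q \<in> Q \<Longrightarrow> q dvd d"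
  shows "Lcm ((\<lambda>q. 2 ^ (d div q) - 1 :: nat) ` Q) > 0"
proof -
  have "2 ^ (d div q) - 1 \<noteq> (0::nat)" if "q \<in> Q" for q
  proof -
    have "d div q \<noteq> 0" using assms(2) assms(3)[OF that] by (simp add: dvd_div_eq_0_iff)
    then have "2 ^ (d div q) > (1::nat)" by (intro one_less_power) auto
    then show ?thesis by linarith
  qed
  then have "0 \<notin> (\<lambda>q. 2 ^ (d div q) - 1 :: nat) ` Q"
    by force
  then show ?thesis using assms(1) by (meson Lcm_0_iff_nat finite_imageI neq0_conv)
qed

lemma cyclotomic_at_2_pos:
  assumes "finite Q" "d > 0" "\<And>q. q \<in> Q \<Longrightarrow> q dvd d"
  shows "cyclotomic_at_2 d Q > 0"
  using assms Lcm_two_power_pos[OF assms] unfolding cyclotomic_at_2_def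
  by (intro divide_pos_pos) auto

text \<open>
  The analogue of \<open>\<Phi>\<^bsub>np\<^esub>(x) = \<Phi>\<^bsub>n\<^esub>(x\<^sup>p) / \<Phi>\<^bsub>n\<^esub>(x)\<close> for \<open>p\<close> not dividing \<open>n\<close>. Adding \<open>a = 2 ^ (d div p) - 1\<close>
  to the numbers under the least common multiple \<open>L\<close> multiplies it by \<open>a / gcd a L\<close>, and by
  distributivity \<open>gcd a L\<close> is the corresponding least common multiple for \<open>d div p\<close>.
\<close>

lemma cyclotomic_at_2_insert:
  assumes "finite Q" "d > 0" "\<And>q. q \<in> insert p Q \<Longrightarrow> prime q \<and> q dvd d" "p \<notin> Q"
  shows "cyclotomic_at_2 d (insert p Q) = cyclotomic_at_2 d Q / cyclotomic_at_2 (d div p) Q"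
    and "\<And>q. q \<in> Q \<Longrightarrow> q dvd d div p"
proof -
  have cop: "q * p dvd d" if "q \<in> Q" for q
    using that assms(3)[of q] assms(3)[of p] assms(4)
    by (intro divides_mult) (auto intro!: primes_coprime)
  show dvd: "q dvd d div p" if "q \<in> Q" for q
    using cop[OF that] assms(3)[of p] by (simp add: dvd_div_iff_mult prime_gt_0_nat)
  let ?L = "\<lambda>d Q. Lcm ((\<lambda>q. 2 ^ (d div q) - 1 :: nat) ` Q)"
  let ?a = "2 ^ (d div p) - 1 :: nat"
  have "gcd ?a (?L d Q) = ?L (d div p) Q"
  proof -
    have "gcd (d div p) (d div q) = d div p div q" if "q \<in> Q" for q
    proof -
      have qp: "coprime q p" using that assms(3)[of q] assms(3)[of p] assms(4)
        by (auto intro!: primes_coprime)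
      have "q * p dvd d" by (rule cop[OF that])
      then obtain e where e: "d = q * p * e" by (elim dvdE)
      have "q > 0" "p > 0" using that assms(3)[of q] assms(3)[of p] by (auto simp: prime_gt_0_nat)
      then have "d div p = q * e" "d div q = p * e" "d div p div q = e"
        unfolding e by (simp_all add: mult.assoc mult.left_commute[of q p])
      moreover have "gcd (q * e) (p * e) = gcd q p * e"
        by (metis gcd_mult_distrib_nat mult.commute)
      moreover have "gcd q p = 1" using qp by (rule coprime_imp_gcd_eq_1)
      ultimately show ?thesis by (simp only: mult_1)
    qed
    then have "(\<lambda>q. gcd ?a (2 ^ (d div q) - 1)) ` Q = (\<lambda>q. 2 ^ (d div p div q) - 1) ` Q"
      unfolding gcd_two_power_minus_one by (intro image_cong refl) (simp only:)
    moreover have "gcd ?a (?L d Q) = Lcm ((\<lambda>q. gcd ?a (2 ^ (d div q) - 1)) ` Q)"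
      using gcd_Lcm_finite[OF finite_imageI[OF assms(1)], of ?a "\<lambda>q. 2 ^ (d div q) - 1"]
      by (simp only: image_image)
    ultimately show ?thesis by (simp only:)
  qed
  then have "?a * ?L d Q = ?L (d div p) Q * ?L d (insert p Q)"
    using prod_gcd_lcm_nat[of ?a "?L d Q"] by (simp only: image_insert Lcm_insert)
  then have eq: "real ?a * real (?L d Q) = real (?L (d div p) Q) * real (?L d (insert p Q))"
    by (metis of_nat_mult)
  have "d div p > 0" using assms(2) assms(3)[of p] by (auto simp: dvd_div_eq_0_iff)
  then have "2 ^ (d div p) > (1::nat)" by (intro one_less_power) auto
  then have "?a > 0" by linarith
  moreover have "?L d Q > 0" "?L d (insert p Q) > 0" "?L (d div p) Q > 0"
    using assms \<open>d div p > 0\<close> dvd by (intro Lcm_two_power_pos; simp)+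
  ultimately show "cyclotomic_at_2 d (insert p Q) = cyclotomic_at_2 d Q / cyclotomic_at_2 (d div p) Q"
    unfolding cyclotomic_at_2_def using eq by (simp add: field_simps)
qed

text \<open>
  Replacing every factor \<open>2 ^ e - 1\<close> by \<open>2 ^ e\<close> would give exactly the exponent
  \<open>d * (\<Prod>q\<in>Q. 1 - 1 / q)\<close>. Each replacement changes the binary logarithm by at most \<open>1\<close>, and
  every step of \<open>cyclotomic_at_2_insert\<close> doubles the number of factors. The crude error
  \<open>2 ^ card Q\<close> suffices because it is negligible against the totient in the application.
\<close>

lemma log_cyclotomic_at_2_approx:
  assumes "finite Q" "d > 0" "\<And>q. q \<in> Q \<Longrightarrow> prime q \<and> q dvd d"
  shows "\<bar>log 2 (cyclotomic_at_2 d Q) - real d * (\<Prod>q\<in>Q. 1 - 1 / real q)\<bar> \<le> 2 ^ card Q"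
  using assms
proof (induction Q arbitrary: d rule: finite_induct)
  case empty
  have "real (2 ^ d - 1) = 2 ^ d - 1" by simp
  moreover have "(2::real) ^ d / 2 \<le> 2 ^ d - 1" 
    using empty(1) one_le_power[of "2::real" "d - 1"] by (cases d) auto
  ultimately have "log 2 (2 ^ d / 2) \<le> log 2 (real (2 ^ d - 1))" "log 2 (real (2 ^ d - 1)) \<le> log 2 (2 ^ d)"
    using empty(1) by (subst log_le_cancel_iff; simp)+
  then show ?case using empty(1)
    by (simp add: cyclotomic_at_2_def log_divide log_nat_power)
next
  case (insert p Q)
  note ci = cyclotomic_at_2_insert[OF insert(1) insert(4) insert(5) insert(2)]
  have p: "p dvd d" "prime p" using insert(5) by auto
  have dp: "d div p > 0" using insert(4) p by (auto simp: dvd_div_eq_0_iff)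
  have 1: "\<bar>log 2 (cyclotomic_at_2 d Q) - real d * (\<Prod>q\<in>Q. 1 - 1 / real q)\<bar> \<le> 2 ^ card Q"
    using insert.IH[of d] insert by auto
  have 2: "\<bar>log 2 (cyclotomic_at_2 (d div p) Q) - real (d div p) * (\<Prod>q\<in>Q. 1 - 1 / real q)\<bar> \<le> 2 ^ card Q"
    using insert.IH[of "d div p"] ci(2) dp insert(5) by auto
  have "log 2 (cyclotomic_at_2 d (insert p Q)) = log 2 (cyclotomic_at_2 d Q) - log 2 (cyclotomic_at_2 (d div p) Q)"
    using ci dp insert by (subst ci(1)) (auto intro!: log_divide_pos cyclotomic_at_2_pos)
  moreover have "real d * (\<Prod>q\<in>insert p Q. 1 - 1 / real q)
      = real d * (\<Prod>q\<in>Q. 1 - 1 / real q) - real (d div p) * (\<Prod>q\<in>Q. 1 - 1 / real q)"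
    using insert(1,2) p by (simp add: algebra_simps real_of_nat_div)
  moreover have "2 ^ card (insert p Q) = 2 * (2::real) ^ card Q" using insert(1,2) by simp
  ultimately show ?case using 1 2 by linarith
qed

text \<open>
  Let \<open>d\<close> be the order of \<open>2\<close> modulo \<open>p\<close>. Then \<open>p\<close> divides \<open>2 ^ d - 1\<close> but none of the numbers
  \<open>2 ^ (d div q) - 1\<close>, hence \<open>p\<close> survives in the quotient by their least common multiple. That
  quotient is a positive integer of size about \<open>2 ^ totient d\<close>, and \<open>d\<close> divides \<open>M\<close>.
\<close>

lemma prime_divisor_two_power_minus_one_le:
  assumes "prime p" "p dvd 2 ^ M - 1" "M > 0"
  shows "log 2 (real p) \<le> real (totient M) + 2 ^ card (prime_factors M)"
proof -
  define d where "d = ord p 2"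
  define Q where "Q = prime_factors d"
  have dvd_iff: "p dvd 2 ^ e - 1 \<longleftrightarrow> d dvd e" for e
  proof -
    have "p dvd 2 ^ e - 1 \<longleftrightarrow> [2 ^ e = 1] (mod p)"
      using one_le_power[of "2::nat" e] by (subst cong_altdef_nat) auto
    then show ?thesis unfolding d_def by (rule trans[OF _ ord_divides])
  qed
  have dM: "d dvd M" using assms(2) dvd_iff by simp
  then have d0: "d > 0" using assms(3) by (auto intro: Nat.gr0I)
  have Q: "finite Q" "\<And>q. q \<in> Q \<Longrightarrow> prime q \<and> q dvd d"
    by (auto simp: Q_def in_prime_factors_iff)
  have qd: "q dvd d" if "q \<in> Q" for q using Q(2)[OF that] by simp
  let ?L = "Lcm ((\<lambda>q. 2 ^ (d div q) - 1 :: nat) ` Q)"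
  have L0: "?L > 0" using Lcm_two_power_pos[OF Q(1) d0] qd by simp
  have "?L dvd 2 ^ d - 1"
  proof (rule Lcm_least)
    fix a assume "a \<in> (\<lambda>q. 2 ^ (d div q) - 1 :: nat) ` Q"
    then obtain q where "q \<in> Q" and a: "a = 2 ^ (d div q) - 1" by blast
    have "d div q dvd d" using qd[OF \<open>q \<in> Q\<close>] by (metis dvd_div_mult_self dvd_triv_left)
    then show "a dvd 2 ^ d - 1" unfolding a by (rule two_power_minus_one_dvd)
  qed
  then obtain D where D: "2 ^ d - 1 = ?L * D" by (elim dvdE)
  have "\<not> p dvd ?L"
  proof
    assume "p dvd ?L"
    moreover have "p dvd Lcm S \<Longrightarrow> \<exists>s\<in>S. p dvd s" if "finite S" for S :: "nat set"
      using that
    proof (induction S rule: finite_induct)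
      case (insert a S)
      have "lcm a (Lcm S) dvd a * Lcm S" by (intro lcm_least) simp_all
      then have "p dvd a * Lcm S" using insert(4) by (auto intro: dvd_trans)
      with insert show ?case using assms(1) by (auto simp: prime_dvd_mult_iff)
    qed (use assms(1) in auto)
    ultimately obtain q where q: "q \<in> Q" "p dvd 2 ^ (d div q) - 1" using Q(1) by blast
    then have "d dvd d div q" using dvd_iff by blast
    moreover have "d div q < d" "d div q > 0"
      using d0 Q(2)[OF q(1)] prime_gt_1_nat[of q] by (auto simp: dvd_div_eq_0_iff intro: div_less_dividend)
    ultimately show False by (auto dest: dvd_imp_le)
  qed
  moreover have "p dvd ?L * D" using dvd_iff[of d] D by simp
  ultimately have "p dvd D" using assms(1) by (auto simp: prime_dvd_mult_iff)
  moreover have "D > 0"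
  proof -
    have "2 ^ d > (1::nat)" using d0 by (intro one_less_power) auto
    then show ?thesis using D by (intro Nat.gr0I) auto
  qed
  ultimately have "p \<le> D" by (auto dest: dvd_imp_le)
  have cD: "cyclotomic_at_2 d Q = real D" unfolding cyclotomic_at_2_def D using L0 by simp
  have "log 2 (real p) \<le> log 2 (cyclotomic_at_2 d Q)"
    using \<open>p \<le> D\<close> prime_gt_0_nat[OF assms(1)] by (simp add: cD)
  also have "\<dots> \<le> real d * (\<Prod>q\<in>Q. 1 - 1 / real q) + 2 ^ card Q"
    using log_cyclotomic_at_2_approx[OF Q(1) d0 Q(2)] by auto
  also have "\<dots> = real (totient d) + 2 ^ card Q"
    by (simp add: totient_formula2 Q_def)
  also have "\<dots> \<le> real (totient M) + 2 ^ card (prime_factors M)"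
  proof (intro add_mono)
    show "real (totient d) \<le> real (totient M)"
      using totient_dvd_mono[OF dM] assms(3) by simp
    show "(2::real) ^ card Q \<le> 2 ^ card (prime_factors M)"
      unfolding Q_def using dM assms(3)
      by (intro power_increasing card_mono dvd_prime_factors) auto
  qed
  finally show ?thesis .
qed

section \<open>An upper bound for the Mertens product\<close>

text \<open>
  Expand every Euler factor as a geometric series: an element of \<open>B\<close> is \<open>p ^ e\<close> times a number
  whose prime factors lie in the smaller set.
\<close>

lemma sum_powr_le_Euler_product:
  fixes s :: real
  assumes "s > 0" "finite A" "\<And>p. p \<in> A \<Longrightarrow> prime p"
    and "finite B" "\<And>n. n \<in> B \<Longrightarrow> n > 0 \<and> prime_factors n \<subseteq> A"
  shows "(\<Sum>n\<in>B. real n powr -s) \<le> (\<Prod>p\<in>A. 1 / (1 - real p powr -s))"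
  using assms(2-)
proof (induction A arbitrary: B rule: finite_induct)
  case empty
  have "B \<subseteq> {1}"
    using empty(3) by (auto simp: prime_factorization_empty_iff)
  then have "(\<Sum>n\<in>B. real n powr -s) \<le> (\<Sum>n\<in>{1}. real n powr -s)"
    by (intro sum_mono2) auto
  then show ?case by simp
next
  case (insert p A)
  have p: "prime p" using insert(4) by auto
  let ?e = "\<lambda>n. multiplicity p n"
  let ?r = "\<lambda>n. n div p ^ ?e n"
  define B' where "B' = ?r ` B"
  define E where "E = Max (?e ` B)"
  define x where "x = real p powr -s"
  have x: "0 < x" "x < 1"
    using p \<open>s > 0\<close> prime_gt_1_nat[OF p] by (auto simp: x_def powr_less_one)
  have dec: "n = p ^ ?e n * ?r n" for n
    using multiplicity_dvd[of p n] by simp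
  have IH: "(\<Sum>n\<in>B'. real n powr -s) \<le> (\<Prod>p\<in>A. 1 / (1 - real p powr -s))"
  proof (rule insert.IH)
    show "finite B'" using insert.prems(2) by (simp add: B'_def)
    fix n' assume "n' \<in> B'"
    then obtain n where n: "n \<in> B" "n' = ?r n" by (auto simp: B'_def)
    then have n0: "n > 0" "prime_factors n \<subseteq> insert p A" using insert.prems(3) by blast+
    have n'0: "n' > 0" using dec[of n] n0 n by (cases "n' = 0") auto
    have "\<not> p dvd n'"
      using n0 p unfolding n by (intro multiplicity_decompose) auto
    moreover have "n' dvd n" using dec[of n] n by (metis dvd_triv_right)
    then have "prime_factors n' \<subseteq> prime_factors n" using n0 by (intro dvd_prime_factors) auto
    ultimately show "n' > 0 \<and> prime_factors n' \<subseteq> A"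
      using n'0 n0(2) by (auto simp: in_prime_factors_iff)
  qed (use insert.prems(1) in auto)
  have inj: "inj_on (\<lambda>n. (?e n, ?r n)) B"
  proof (rule inj_onI)
    fix m n assume "(?e m, ?r m) = (?e n, ?r n)"
    then have *: "?e m = ?e n \<and> ?r m = ?r n" by (rule prod.inject[THEN iffD1])
    have "p ^ ?e m * ?r m = p ^ ?e n * ?r n"
      by (rule arg_cong2[where f = "\<lambda>e r. p ^ e * r", OF conjunct1[OF *] conjunct2[OF *]])
    then show "m = n" by (simp only: dec[symmetric])
  qed
  have "(\<Sum>n\<in>B. real n powr -s) = (\<Sum>n\<in>B. (\<lambda>(e, r). x ^ e * real r powr -s) (?e n, ?r n))"
  proof (intro sum.cong refl)
    fix n assume "n \<in> B"
    have "real n = real p ^ ?e n * real (?r n)"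
      unfolding of_nat_mult[symmetric] of_nat_power[symmetric] dec[of n, symmetric] ..
    then have "real n powr -s = (real p ^ ?e n) powr -s * real (?r n) powr -s"
      by (simp only: powr_mult of_nat_0_le_iff zero_le_power)
    also have "(real p ^ ?e n) powr -s = x ^ ?e n"
    proof -
      have "(real p ^ ?e n) powr -s = (real p powr real (?e n)) powr -s"
        using prime_gt_0_nat[OF p] by (subst powr_realpow) auto
      also have "\<dots> = x powr real (?e n)"
        unfolding x_def powr_powr by (simp only: mult.commute)
      also have "\<dots> = x ^ ?e n" using x by (intro powr_realpow) auto
      finally show ?thesis .
    qed
    finally show "real n powr -s = (\<lambda>(e, r). x ^ e * real r powr -s) (?e n, ?r n)" by simp
  qed
  also have "\<dots> = (\<Sum>z\<in>(\<lambda>n. (?e n, ?r n)) ` B. (\<lambda>(e, r). x ^ e * real r powr -s) z)"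
    by (subst sum.reindex[OF inj]) simp
  also have "\<dots> \<le> (\<Sum>z\<in>{..E} \<times> B'. (\<lambda>(e, r). x ^ e * real r powr -s) z)"
    using insert.prems(2) x by (intro sum_mono2) (auto simp: B'_def E_def)
  also have "\<dots> = (\<Sum>e\<le>E. x ^ e) * (\<Sum>r\<in>B'. real r powr -s)"
    by (simp add: sum_product sum.cartesian_product)
  also have "\<dots> \<le> (1 / (1 - x)) * (\<Prod>p\<in>A. 1 / (1 - real p powr -s))"
  proof (intro mult_mono IH)
    have "(\<Sum>e\<le>E. x ^ e) \<le> (\<Sum>e. x ^ e)"
      using x by (intro sum_le_suminf summable_geometric) auto
    then show "(\<Sum>e\<le>E. x ^ e) \<le> 1 / (1 - x)" using x by (simp add: suminf_geometric)
  qed (use x in \<open>auto intro: sum_nonneg\<close>)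
  also have "\<dots> = (\<Prod>p\<in>insert p A. 1 / (1 - real p powr -s))"
    using insert.hyps by (simp add: x_def)
  finally show ?case .
qed

text \<open>
  The integral comparison for the zeta function near its pole, in telescoping form: by convexity
  \<open>(n powr -\<delta> - (n + 1) powr -\<delta>) / \<delta>\<close> is at most the \<open>n\<close>-th term.
\<close>

lemma partial_zeta_ge:
  fixes \<delta> :: real
  assumes "\<delta> > 0"
  shows "(1 - real (Suc X) powr -\<delta>) / \<delta> \<le> (\<Sum>n\<in>{1..X}. real n powr -(1 + \<delta>))"
proof (induction X)
  case (Suc X)
  define n where "n = real (Suc X)"
  have n: "n > 0" "real (Suc (Suc X)) = n + 1" by (auto simp: n_def)
  have "n powr -\<delta> - (n + 1) powr -\<delta> \<le> \<delta> * n powr -(1 + \<delta>)"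
  proof -
    have "ln (1 + 1 / n) \<le> 1 / n" using n by (intro ln_add_one_self_le_self) auto
    then have "1 - \<delta> / n \<le> 1 + (-\<delta>) * ln (1 + 1 / n)"
      using mult_left_mono[of _ _ \<delta>] assms by fastforce
    also have "\<dots> \<le> exp ((-\<delta>) * ln (1 + 1 / n))"
      by (rule exp_ge_add_one_self)
    also have "\<dots> = (1 + 1 / n) powr -\<delta>"
      using n add_pos_pos[of 1 "1 / n"] by (simp add: powr_def)
    finally have "n powr -\<delta> * (1 - \<delta> / n) \<le> n powr -\<delta> * (1 + 1 / n) powr -\<delta>"
      by (intro mult_left_mono) auto
    also have "\<dots> = (n + 1) powr -\<delta>"
    proof -
      have "n * (1 + 1 / n) = n + 1" using n(1) by (simp add: field_simps)
      then have "(n + 1) powr -\<delta> = (n * (1 + 1 / n)) powr -\<delta>" by (simp only:)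
      also have "\<dots> = n powr -\<delta> * (1 + 1 / n) powr -\<delta>" by (rule powr_mult)
      finally show ?thesis by (rule sym)
    qed
    also have "n powr -\<delta> * (1 - \<delta> / n) = n powr -\<delta> - \<delta> * n powr -(1 + \<delta>)"
      using n by (simp add: powr_diff powr_minus divide_simps)
    finally show ?thesis by simp
  qed
  then have "(n powr -\<delta> - (n + 1) powr -\<delta>) / \<delta> \<le> n powr -(1 + \<delta>)"
    using assms by (simp add: field_simps)
  then show ?case using Suc assms
    by (simp add: n(2) n_def[symmetric] diff_divide_distrib del: of_nat_Suc)
qed simp

text \<open>
  This is where Euler's constant enters: \<open>Gamma\<close> has derivative \<open>- euler_mascheroni\<close> at \<open>1\<close>.
\<close>

lemma Gamma_slope_at_1:
  assumes "\<eta> > (0::real)"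
  obtains \<epsilon> where "\<epsilon> > 0" "(Gamma (1 + \<epsilon>) - 1) / \<epsilon> < - euler_mascheroni + \<eta>"
proof -
  have "(Gamma has_field_derivative Gamma 1 * Digamma 1) (at (1::real))"
    by (rule has_field_derivative_Gamma) auto
  then have "(Gamma has_field_derivative - euler_mascheroni) (at (1::real))"
    by simp
  then have lim: "((\<lambda>h::real. (Gamma (1 + h) - 1) / h) \<longlongrightarrow> - euler_mascheroni) (at 0)"
    by (simp add: DERIV_def)
  then have "((\<lambda>h::real. (Gamma (1 + h) - 1) / h) \<longlongrightarrow> - euler_mascheroni) (at_right 0)"
    by (rule filterlim_at_split[THEN iffD1, THEN conjunct2])
  then have "eventually (\<lambda>h::real. (Gamma (1 + h) - 1) / h < - euler_mascheroni + \<eta>) (at_right 0)"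
    using assms by (intro order_tendstoD) auto
  then obtain b where "b > 0" and b: "\<And>h. 0 < h \<Longrightarrow> h < b \<Longrightarrow> (Gamma (1 + h) - 1) / h < - euler_mascheroni + \<eta>"
    unfolding eventually_at_right_field by auto
  then show ?thesis by (intro that[of "b / 2"] b) simp_all
qed

text \<open>
  Partial summation in the variable \<open>u = \<delta> * ln p\<close>: write \<open>p powr -\<delta>\<close> as the integral of
  \<open>exp (-u)\<close> from \<open>\<delta> * ln p\<close> to infinity and interchange the finite sum with the integral.
\<close>

lemma sum_powr_eq_Laplace:
  fixes a :: "nat \<Rightarrow> real"
  assumes "\<delta> > 0" "finite A" "\<And>p. p \<in> A \<Longrightarrow> p \<ge> 1"
  shows "((\<lambda>u. (\<Sum>p | p \<in> A \<and> \<delta> * ln (real p) \<le> u. a p) * exp (-u)) has_integral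
           (\<Sum>p\<in>A. a p * real p powr -\<delta>)) {0..}"
proof -
  have "((\<lambda>u. a p * (if u \<in> {\<delta> * ln (real p)..} then exp (-u) else 0)) has_integral
          a p * real p powr -\<delta>) {0..}" if "p \<in> A" for p
  proof (rule has_integral_mult_right)
    have p: "p \<ge> 1" using assms that by auto
    have "((\<lambda>u. exp (-1 * u)) has_integral exp (-1 * (\<delta> * ln (real p))) / 1) {\<delta> * ln (real p)..}"
      by (rule has_integral_exp_minus_to_infinity) auto
    moreover have "exp (-1 * (\<delta> * ln (real p))) = real p powr -\<delta>"
      using p by (simp add: powr_def)
    ultimately have "((\<lambda>u. exp (-u)) has_integral real p powr -\<delta>) {\<delta> * ln (real p)..}"
      by simp
    then show "((\<lambda>u. if u \<in> {\<delta> * ln (real p)..} then exp (-u) else 0) has_integral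
        real p powr -\<delta>) {0..}"
      using p assms(1) by (subst has_integral_restrict) auto
  qed
  then have "((\<lambda>u. \<Sum>p\<in>A. a p * (if u \<in> {\<delta> * ln (real p)..} then exp (-u) else 0)) has_integral
          (\<Sum>p\<in>A. a p * real p powr -\<delta>)) {0..}"
    using assms by (intro has_integral_sum) auto
  moreover have "(\<Sum>p\<in>A. a p * (if u \<in> {\<delta> * ln (real p)..} then exp (-u) else 0))
      = (\<Sum>p | p \<in> A \<and> \<delta> * ln (real p) \<le> u. a p) * exp (-u)" for u
  proof -
    have "(\<Sum>p\<in>A. a p * (if u \<in> {\<delta> * ln (real p)..} then exp (-u) else 0))
      = (\<Sum>p\<in>A. if \<delta> * ln (real p) \<le> u then a p * exp (-u) else 0)"
      by (intro sum.cong) auto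
    also have "\<dots> = (\<Sum>p | p \<in> A \<and> \<delta> * ln (real p) \<le> u. a p * exp (-u))"
      using assms(2) by (simp add: sum.inter_filter)
    finally show ?thesis by (simp add: sum_distrib_right)
  qed
  ultimately show ?thesis by simp
qed

text \<open>
  Convexity of \<open>exp\<close> between \<open>0\<close> and \<open>ln (1 - y)\<close>. With \<open>y = 1 / p\<close> and \<open>t = p powr -\<delta>\<close> it bounds
  the logarithm of an Euler factor at \<open>1 + \<delta>\<close> by \<open>p powr -\<delta>\<close> times the logarithm of the factor
  at \<open>1\<close>.
\<close>

lemma neg_ln_one_minus_mult_le:
  fixes t y :: real
  assumes "0 \<le> t" "t \<le> 1" "0 \<le> y" "y < 1"
  shows "- ln (1 - t * y) \<le> t * (- ln (1 - y))"
proof -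
  have pos: "1 - t * y > 0"
    using assms by (metis diff_gt_0_iff_gt le_less_trans mult_left_le_one_le)
  have "exp (t * ln (1 - y)) \<le> 1 + t * (exp (ln (1 - y)) - 1)"
    using convex_onD[OF exp_convex, of t 0 "ln (1 - y)"] assms by (simp add: algebra_simps)
  then have "exp (t * ln (1 - y)) \<le> 1 - t * y" using assms by (simp add: algebra_simps)
  then have "t * ln (1 - y) \<le> ln (1 - t * y)" using pos by (simp add: ln_ge_iff)
  then show ?thesis by simp
qed

text \<open>
  One inequality of Mertens' third theorem, along infinitely many \<open>n\<close>. Let \<open>S n\<close> be the negative
  logarithm of the product, and suppose that \<open>S n \<le> \<gamma> - \<eta> + ln (ln n)\<close> for all large \<open>n\<close>. Summing by
  parts against \<open>exp (-u)\<close>, with \<open>n = exp (u / \<delta>)\<close>, turns this into a bound for the logarithm of the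
  Euler product at \<open>1 + \<delta>\<close>, namely
  \<open>\<gamma> - \<eta> + ln (1 / \<delta>) + \<integral> exp (-u) * ln u\<close>. The integral equals \<open>- \<gamma>\<close>, so the product would be
  at most about \<open>exp (-\<eta>) / \<delta>\<close>, whereas the zeta function is at least \<open>1 / \<delta>\<close> there.

  The inequality \<open>ln u \<le> (u powr \<epsilon> - 1) / \<epsilon>\<close> reduces the logarithmic integral to a value of
  \<open>Gamma\<close>. It has a second benefit: the right-hand side is bounded below by \<open>- 1 / \<epsilon>\<close>, so
  for small \<open>\<delta>\<close> the resulting bound (\<open>h\<close> in the proof) also dominates \<open>S\<close> on the initial
  range where the assumed bound is not available.
\<close>

lemma Mertens_product_infinitely_often:
  assumes "\<eta> > (0::real)"
  shows "\<exists>n\<ge>n0. (\<Prod>p | prime p \<and> p \<le> n. 1 - 1 / real p) < exp (- euler_mascheroni + \<eta>) / ln (real n)"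
proof (rule ccontr)
  assume contra: "\<not> ?thesis"
  \<comment> \<open>At least \<open>3\<close>, so that \<open>ln (ln n)\<close> is defined and positive for \<open>n \<ge> n1\<close>.\<close>
  define n1 where "n1 = max 3 n0"
  define P where "P = (\<lambda>n::nat. {p. prime p \<and> p \<le> n})"
  define a where "a = (\<lambda>p::nat. - ln (1 - 1 / real p))"
  define S where "S = (\<lambda>n. \<Sum>p\<in>P n. a p)"
  define \<gamma> where "\<gamma> = (euler_mascheroni :: real)"
  have fin: "finite (P n)" for n by (auto simp: P_def)
  have P: "prime p" "1 - 1 / real p > 0" "a p \<ge> 0" if "p \<in> P n" for p n
  proof -
    show "prime p" using that by (auto simp: P_def)
    then show "1 - 1 / real p > 0" using prime_gt_1_nat[of p] by simp
    then show "a p \<ge> 0" by (simp add: a_def)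
  qed
  have S_mono: "S m \<le> S n" if "m \<le> n" for m n
    unfolding S_def using that P(3)[of _ n] fin by (intro sum_mono2) (auto simp: P_def)
  have S_le: "S n \<le> \<gamma> - \<eta> + ln (ln (real n))" if "n \<ge> n1" for n
  proof -
    have n: "n \<ge> n0" "ln (real n) > 0" using that by (auto simp: n1_def)
    have "exp (- \<gamma> + \<eta>) / ln (real n) \<le> (\<Prod>p\<in>P n. 1 - 1 / real p)"
      using contra n by (auto simp: P_def \<gamma>_def not_less)
    then have "ln (exp (- \<gamma> + \<eta>) / ln (real n)) \<le> ln (\<Prod>p\<in>P n. 1 - 1 / real p)"
      using n by (intro ln_mono) auto
    also have "\<dots> = - S n"
      using P(2) fin unfolding S_def a_def sum_negf minus_minus by (intro ln_prod) (blast, force)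
    finally show ?thesis using n by (simp add: ln_div)
  qed
  obtain \<epsilon> where \<epsilon>: "\<epsilon> > 0" "(Gamma (1 + \<epsilon>) - 1) / \<epsilon> < - \<gamma> + \<eta> / 2"
    using Gamma_slope_at_1[of "\<eta> / 2"] assms unfolding \<gamma>_def by auto
  \<comment> \<open>Chosen so that \<open>h 0 = S n1\<close>; since \<open>h\<close> increases, this covers all \<open>u\<close> with \<open>n < n1\<close>.\<close>
  define \<delta> where "\<delta> = exp (\<gamma> - \<eta> - 1 / \<epsilon> - S n1)"
  have \<delta>: "\<delta> > 0" by (simp add: \<delta>_def)
  define h where "h = (\<lambda>u. \<gamma> - \<eta> + ln (1 / \<delta>) + (u powr \<epsilon> - 1) / \<epsilon>)"
  have T_le: "(\<Sum>p | p \<in> P X \<and> \<delta> * ln (real p) \<le> u. a p) \<le> h u" if "u \<ge> 0" for u X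
  proof -
    define n where "n = nat \<lfloor>exp (u / \<delta>)\<rfloor>"
    have "{p. p \<in> P X \<and> \<delta> * ln (real p) \<le> u} \<subseteq> P n"
    proof safe
      fix p assume p: "p \<in> P X" "\<delta> * ln (real p) \<le> u"
      then have "ln (real p) \<le> u / \<delta>" using \<delta> by (simp add: field_simps)
      then have "real p \<le> exp (u / \<delta>)"
        using prime_gt_0_nat[OF P(1)[OF p(1)]] by (metis exp_le_cancel_iff exp_ln of_nat_0_less_iff)
      then show "p \<in> P n" using P(1)[OF p(1)] by (simp add: P_def n_def le_nat_floor)
    qed
    then have "(\<Sum>p | p \<in> P X \<and> \<delta> * ln (real p) \<le> u. a p) \<le> S n"
      unfolding S_def using fin P(3) by (intro sum_mono2) auto
    also have "S n \<le> h u"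
    proof (cases "n \<ge> n1")
      case True
      have n3: "n \<ge> 3" using True by (simp add: n1_def)
      have "real n \<le> exp (u / \<delta>)" unfolding n_def by simp
      then have le: "ln (real n) \<le> u / \<delta>"
        using n3 by (metis ln_exp ln_mono of_nat_0_less_iff less_le_trans zero_less_numeral)
      have l: "ln (real n) > 0" using n3 by simp
      with le have "u / \<delta> > 0" by simp
      then have u: "u > 0" using \<delta> by (simp add: zero_less_divide_iff)
      have "ln (ln (real n)) \<le> ln (u / \<delta>)" using le l by (rule ln_mono)
      also have "\<dots> = ln (1 / \<delta>) + ln u" using u \<delta> by (simp add: ln_div)
      also have "ln u \<le> (u powr \<epsilon> - 1) / \<epsilon>"
        using ln_le_minus_one[of "u powr \<epsilon>"] u \<epsilon>(1) by (simp add: ln_powr pos_le_divide_eq mult.commute)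
      finally show ?thesis using S_le[OF True] by (simp add: h_def)
    next
      case False
      have "S n \<le> S n1" using False by (intro S_mono) auto
      also have "S n1 = \<gamma> - \<eta> + ln (1 / \<delta>) + (0 - 1) / \<epsilon>"
        by (simp add: \<delta>_def ln_div)
      also have "\<dots> \<le> h u"
        unfolding h_def using \<epsilon>(1) by (intro add_left_mono divide_right_mono) auto
      finally show ?thesis .
    qed
    finally show ?thesis .
  qed
  have h_int: "((\<lambda>u. h u * exp (-u)) has_integral
      (\<gamma> - \<eta> + ln (1 / \<delta>) - 1 / \<epsilon>) * 1 + Gamma (1 + \<epsilon>) / \<epsilon>) {0..}"
  proof -
    have "((\<lambda>u::real. exp (-1 * u)) has_integral exp (-1 * 0) / 1) {0..}"
      by (rule has_integral_exp_minus_to_infinity) auto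
    then have "((\<lambda>u::real. exp (-u)) has_integral 1) {0..}" by simp
    then have 1: "((\<lambda>u::real. (\<gamma> - \<eta> + ln (1 / \<delta>) - 1 / \<epsilon>) * exp (-u)) has_integral
         (\<gamma> - \<eta> + ln (1 / \<delta>) - 1 / \<epsilon>) * 1) {0..}"
      by (rule has_integral_mult_right)
    have 2: "((\<lambda>u. u powr (1 + \<epsilon> - 1) / exp u / \<epsilon>) has_integral Gamma (1 + \<epsilon>) / \<epsilon>) {0..}"
      using \<epsilon>(1) by (intro has_integral_divide Gamma_integral_real) auto
    have "(\<gamma> - \<eta> + ln (1 / \<delta>) - 1 / \<epsilon>) * exp (-u) + u powr (1 + \<epsilon> - 1) / exp u / \<epsilon> = h u * exp (-u)" for u
      unfolding h_def by (simp add: exp_minus divide_inverse algebra_simps)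
    with has_integral_add[OF 1 2] show ?thesis by (simp only:)
  qed
  have bound: "(\<Sum>p\<in>P X. a p * real p powr -\<delta>) \<le> ln (1 / \<delta>) - \<eta> / 2" for X
  proof -
    have "(\<Sum>p\<in>P X. a p * real p powr -\<delta>) \<le> (\<gamma> - \<eta> + ln (1 / \<delta>) - 1 / \<epsilon>) * 1 + Gamma (1 + \<epsilon>) / \<epsilon>"
    proof (rule has_integral_le[OF sum_powr_eq_Laplace h_int])
      show "p \<ge> 1" if "p \<in> P X" for p using prime_gt_0_nat[OF P(1)[OF that]] by simp
      show "(\<Sum>p | p \<in> P X \<and> \<delta> * ln (real p) \<le> u. a p) * exp (-u) \<le> h u * exp (-u)"
        if "u \<in> {0..}" for u
        using that by (intro mult_right_mono T_le) auto
    qed (rule \<delta>, rule fin)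
    also have "\<dots> = \<gamma> - \<eta> + ln (1 / \<delta>) + (Gamma (1 + \<epsilon>) - 1) / \<epsilon>"
      by (simp add: diff_divide_distrib)
    finally show ?thesis using \<epsilon>(2) by simp
  qed
  have euler: "(1 - real (Suc X) powr -\<delta>) / \<delta> \<le> exp (- \<eta> / 2) / \<delta>" for X
  proof -
    have pos: "1 - real p powr -(1 + \<delta>) > 0" if "p \<in> P X" for p
      using \<delta> prime_gt_1_nat[OF P(1)[OF that]] by (simp add: powr_less_one)
    have "(1 - real (Suc X) powr -\<delta>) / \<delta> \<le> (\<Sum>n\<in>{1..X}. real n powr -(1 + \<delta>))"
      by (rule partial_zeta_ge[OF \<delta>])
    also have "\<dots> \<le> (\<Prod>p\<in>P X. 1 / (1 - real p powr -(1 + \<delta>)))"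
    proof (rule sum_powr_le_Euler_product)
      fix n assume n: "n \<in> {1..X}"
      have "p \<le> X" if "p dvd n" for p using dvd_imp_le[OF that] n by simp
      then show "n > 0 \<and> prime_factors n \<subseteq> P X"
        using n by (auto simp: P_def in_prime_factors_iff)
    qed (use \<delta> fin P(1) in auto)
    also have "\<dots> = exp (\<Sum>p\<in>P X. - ln (1 - real p powr -(1 + \<delta>)))"
      using fin pos by (simp add: exp_sum exp_minus divide_inverse)
    also have "\<dots> \<le> exp (\<Sum>p\<in>P X. a p * real p powr -\<delta>)"
    proof (subst exp_le_cancel_iff, rule sum_mono)
      fix p assume p: "p \<in> P X"
      have p1: "real p > 1" using prime_gt_1_nat[OF P(1)[OF p]] by simp
      have "real p powr -(1 + \<delta>) = real p powr -\<delta> * (1 / real p)"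
        using p1 by (simp add: powr_diff powr_minus divide_simps)
      moreover have "real p powr -\<delta> \<le> 1" using p1 \<delta> by (simp add: powr_less_one less_imp_le)
      ultimately show "- ln (1 - real p powr -(1 + \<delta>)) \<le> a p * real p powr -\<delta>"
        using neg_ln_one_minus_mult_le[of "real p powr -\<delta>" "1 / real p"] p1 by (simp add: a_def mult.commute)
    qed
    also have "\<dots> \<le> exp (ln (1 / \<delta>) - \<eta> / 2)" using bound by simp
    also have "\<dots> = exp (ln (1 / \<delta>)) * exp (- \<eta> / 2)" by (simp flip: exp_add)
    also have "exp (ln (1 / \<delta>)) = 1 / \<delta>" using \<delta> by (intro exp_ln) simp
    finally show ?thesis by simp
  qed
  have "(\<lambda>X. real (Suc X) powr -\<delta>) \<longlonglongrightarrow> 0"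
    using \<delta> by (intro tendsto_neg_powr filterlim_compose[OF filterlim_real_sequentially filterlim_Suc]) auto
  then have "eventually (\<lambda>X. real (Suc X) powr -\<delta> < 1 - exp (- \<eta> / 2)) sequentially"
    using assms by (intro order_tendstoD) auto
  then obtain X where "real (Suc X) powr -\<delta> < 1 - exp (- \<eta> / 2)"
    by (auto simp: eventually_sequentially)
  moreover have "1 - real (Suc X) powr -\<delta> \<le> exp (- \<eta> / 2)"
    using euler[of X] \<delta> by (simp add: divide_le_cancel del: of_nat_Suc)
  ultimately show False by linarith
qed

section \<open>Smooth numbers with few non-zero digits\<close>

definition odd_primorial :: "nat \<Rightarrow> nat" where
  "odd_primorial x = (\<Prod>p | prime p \<and> odd p \<and> p \<le> x. p)"

lemma odd_primorial_pos: "odd_primorial x > 0"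
  unfolding odd_primorial_def by (intro prod_pos) (auto simp: prime_gt_0_nat)

lemma primes_le_eq_insert_2:
  assumes "x \<ge> (2::nat)"
  shows "{p. prime p \<and> p \<le> x} = insert 2 {p. prime p \<and> odd p \<and> p \<le> x}"
  using assms primes_dvd_imp_eq[of "2::nat"] by auto

lemma prime_factors_2_odd_primorial:
  assumes "x \<ge> 2"
  shows "prime_factors (2 * odd_primorial x) = {p. prime p \<and> p \<le> x}"
proof -
  have "p dvd 2 * odd_primorial x \<longleftrightarrow> p \<le> x" if "prime p" for p
  proof -
    have "p dvd 2 * odd_primorial x \<longleftrightarrow> p dvd (\<Prod>p | prime p \<and> p \<le> x. p)"
      by (simp add: primes_le_eq_insert_2[OF assms] odd_primorial_def)
    also have "\<dots> \<longleftrightarrow> (\<exists>r\<in>{p. prime p \<and> p \<le> x}. p dvd r)"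
      using that by (intro prime_dvd_prod_iff) auto
    also have "\<dots> \<longleftrightarrow> p \<le> x" using that by (auto dest: primes_dvd_imp_eq)
    finally show ?thesis .
  qed
  then show ?thesis using odd_primorial_pos[of x] by (auto simp: in_prime_factors_iff)
qed

lemma prime_le_odd_primorial:
  assumes "prime q" "odd q" "q \<le> x"
  shows "q \<le> odd_primorial x"
proof -
  have "q dvd odd_primorial x"
    unfolding odd_primorial_def using assms by (intro dvd_prodI) auto
  then show ?thesis using odd_primorial_pos by (rule dvd_imp_le)
qed

text \<open>
  Far from sharp, but only the iterated logarithm of the primorial matters, and the extra
  factor \<open>ln x\<close> disappears there.
\<close>

lemma ln_odd_primorial_le: "ln (real (odd_primorial x)) \<le> real x * ln (real x)"
proof (cases "x = 0")
  case False
  let ?A = "{p. prime p \<and> odd p \<and> p \<le> x}"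
  have "card ?A \<le> card {1..x}"
    by (intro card_mono) (auto dest: prime_gt_0_nat simp: Suc_le_eq)
  then have "real (card ?A) \<le> real x" by simp
  have "ln (real (odd_primorial x)) = (\<Sum>p\<in>?A. ln (real p))"
    unfolding odd_primorial_def of_nat_prod by (rule ln_prod) (auto simp: prime_gt_0_nat)
  also have "\<dots> \<le> (\<Sum>p\<in>?A. ln (real x))"
    using False by (intro sum_mono) (auto simp: prime_gt_0_nat)
  also have "\<dots> \<le> real x * ln (real x)"
    using False \<open>real (card ?A) \<le> real x\<close> by (simp add: mult_right_mono)
  finally show ?thesis .
next
  case True
  then have none: "{p. prime p \<and> odd p \<and> p \<le> x} = {}"
    by (auto dest: prime_gt_0_nat)
  show ?thesis unfolding odd_primorial_def none by (simp add: True)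
qed

text \<open>
  The totient is the product of \<open>p - 1\<close> over the odd primes up to \<open>x\<close>. Each factor is at least
  \<open>2\<close>, which matches the power of two, and the factor at \<open>q\<close> is much larger. The constant \<open>4\<close> comes
  from the two primes \<open>2\<close> and \<open>q\<close> that are not matched.
\<close>

lemma two_power_omega_le_totient:
  assumes "prime q" "odd q" "q \<le> x"
  shows "2 ^ card (prime_factors (2 * odd_primorial x))
           \<le> 4 / (real q - 1) * real (totient (2 * odd_primorial x))"
proof -
  let ?A = "{p. prime p \<and> odd p \<and> p \<le> x}"
  have q3: "q \<ge> 3" using assms prime_ge_2_nat[of q] by (cases "q = 2") auto
  have x: "x \<ge> 2" using q3 assms by simp
  have fin: "finite ?A" by simp
  have "real (totient (2 * odd_primorial x))
      = real (2 * odd_primorial x) * (\<Prod>p\<in>insert 2 ?A. 1 - 1 / real p)"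
    using x by (simp add: totient_formula2 prime_factors_2_odd_primorial primes_le_eq_insert_2)
  also have "\<dots> = (\<Prod>p\<in>?A. real p) * (\<Prod>p\<in>?A. 1 - 1 / real p)"
    by (subst prod.insert) (auto simp: odd_primorial_def)
  also have "\<dots> = (\<Prod>p\<in>?A. real p - 1)"
    by (subst prod.distrib[symmetric], intro prod.cong) (auto dest: prime_gt_0_nat simp: algebra_simps)
  finally have tot: "real (totient (2 * odd_primorial x)) = (\<Prod>p\<in>?A. real p - 1)" .
  have ge: "p \<ge> 3" if "p \<in> ?A" for p
    using that prime_ge_2_nat[of p] by (cases "p = 2") auto
  have "card (prime_factors (2 * odd_primorial x)) = Suc (card ?A)"
    using x by (simp add: prime_factors_2_odd_primorial primes_le_eq_insert_2)
  also have "card ?A = Suc (card (?A - {q}))"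
    using assms by (intro card.remove) auto
  finally have "(2::real) ^ card (prime_factors (2 * odd_primorial x)) = 4 * 2 ^ card (?A - {q})"
    by simp
  also have "(2::real) ^ card (?A - {q}) = (\<Prod>p\<in>?A - {q}. 2)" by simp
  also have "\<dots> \<le> (\<Prod>p\<in>?A - {q}. real p - 1)"
    using ge by (intro prod_mono) force
  also have "\<dots> = (\<Prod>p\<in>?A. real p - 1) / (real q - 1)"
    using assms q3 by (subst prod.remove[OF fin, of q]) auto
  finally show ?thesis by (simp add: tot)
qed

text \<open>
  The number \<open>2 ^ m + 1\<close> divides \<open>2 ^ (2 * m) - 1\<close>, and for odd \<open>m\<close> the even number \<open>2 * m\<close> has the same
  totient as \<open>m\<close>. Expressed through all primes up to \<open>x\<close>, this gives the factor \<open>2\<close> in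
  \<open>2 * exp (- euler_mascheroni)\<close>.
\<close>

lemma ln_prime_divisor_le:
  assumes q: "prime q" "odd q" "q \<le> x"
    and p: "prime p" "p dvd (2 ^ odd_primorial x + 1) ^ k"
  shows "ln (real p) \<le> ln 2 * ((1 + 4 / (real q - 1)) *
           (2 * real (odd_primorial x) * (\<Prod>p | prime p \<and> p \<le> x. 1 - 1 / real p)))"
proof -
  define m where "m = odd_primorial x"
  have m: "m > 0" using odd_primorial_pos by (simp add: m_def)
  have x: "x \<ge> 2" using prime_ge_2_nat[OF q(1)] q(3) by simp
  have "p dvd 2 ^ m + 1" using prime_dvd_power[OF p] by (simp add: m_def)
  moreover have "(2::nat) ^ (2 * m) - 1 = (2 ^ m - 1) * (2 ^ m + 1)"
  proof -
    have "(2::nat) ^ (2 * m) = 2 ^ m * 2 ^ m" by (simp add: mult_2 power_add)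
    then show ?thesis by (simp add: algebra_simps)
  qed
  ultimately have "p dvd 2 ^ (2 * m) - 1" by (simp only: dvd_mult)
  then have "log 2 (real p) \<le> real (totient (2 * m)) + 2 ^ card (prime_factors (2 * m))"
    using m p by (intro prime_divisor_two_power_minus_one_le) auto
  also have "\<dots> \<le> (1 + 4 / (real q - 1)) * real (totient (2 * m))"
    using two_power_omega_le_totient[OF q] by (simp add: m_def distrib_right)
  also have "real (totient (2 * m)) = 2 * real m * (\<Prod>p | prime p \<and> p \<le> x. 1 - 1 / real p)"
    using x by (simp add: totient_formula2 m_def prime_factors_2_odd_primorial)
  finally show ?thesis by (simp add: log_def m_def field_simps)
qed

text \<open>
  The exponent \<open>k\<close> in \<open>(2 ^ m + 1) ^ k\<close>. As that number has about \<open>n = m * k\<close> binary digits, the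
  choice balances \<open>k \<approx> n powr (\<alpha> / 2)\<close> with \<open>m \<approx> n powr (1 - \<alpha> / 2)\<close>.
\<close>

definition block_exponent :: "real \<Rightarrow> nat \<Rightarrow> nat" where
  "block_exponent \<alpha> m = nat \<lfloor>real m powr (\<alpha> / (2 - \<alpha>))\<rfloor>"

context
  fixes \<alpha> :: real
  assumes \<alpha>: "0 \<le> \<alpha>" "\<alpha> \<le> 1"
begin

lemma block_exponent_le: "real (block_exponent \<alpha> m) \<le> real m powr (\<alpha> / (2 - \<alpha>))"
  by (simp add: block_exponent_def)

lemma block_exponent_bounds:
  assumes "m > 0"
  shows "block_exponent \<alpha> m \<ge> 1" "block_exponent \<alpha> m \<le> m"
proof -
  have "real m powr (\<alpha> / (2 - \<alpha>)) \<ge> 1" using assms \<alpha> by (intro ge_one_powr_ge_zero) auto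
  then show "block_exponent \<alpha> m \<ge> 1" by (simp add: block_exponent_def le_nat_iff)
  have "real m powr (\<alpha> / (2 - \<alpha>)) \<le> real m powr 1"
    using assms \<alpha> by (intro powr_mono) (auto simp: field_simps)
  then show "block_exponent \<alpha> m \<le> m" using block_exponent_le[of m] assms by simp
qed

text \<open>
  Rounding down makes this exact rather than asymptotic, so the leading term of the digit count
  incurs no error.
\<close>

lemma block_exponent_le_powr:
  assumes "m > 0"
  shows "real (block_exponent \<alpha> m) \<le> (real m * real (block_exponent \<alpha> m)) powr (\<alpha> / 2)"
proof -
  define k where "k = real (block_exponent \<alpha> m)"
  have k: "k \<ge> 1" "k \<le> real m powr (\<alpha> / (2 - \<alpha>))"
    using block_exponent_bounds[OF assms] block_exponent_le[of m] by (simp_all add: k_def)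
  have "k powr (1 - \<alpha> / 2) \<le> (real m powr (\<alpha> / (2 - \<alpha>))) powr (1 - \<alpha> / 2)"
    using k \<alpha> by (intro powr_mono2) auto
  also have "\<dots> = real m powr (\<alpha> / 2)"
  proof -
    have "\<alpha> / (2 - \<alpha>) * (1 - \<alpha> / 2) = \<alpha> / 2" using \<alpha> by (simp add: field_simps)
    then show ?thesis by (simp only: powr_powr)
  qed
  finally have "k powr (1 - \<alpha> / 2) * k powr (\<alpha> / 2) \<le> real m powr (\<alpha> / 2) * k powr (\<alpha> / 2)"
    by (intro mult_right_mono) auto
  then show ?thesis using k by (simp add: powr_mult flip: powr_add k_def)
qed

text \<open>
  For \<open>\<alpha> = 0\<close> the exponent is constantly \<open>1\<close> and there is no rounding error; otherwise the power
  tends to infinity and rounding becomes negligible.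
\<close>

lemma block_exponent_asymp:
  assumes "\<eta> > 0"
  shows "eventually (\<lambda>m. real (block_exponent \<alpha> m) \<ge> (1 - \<eta>) * real m powr (\<alpha> / (2 - \<alpha>))) at_top"
proof (cases "\<alpha> = 0")
  case True
  show ?thesis
    using eventually_gt_at_top[of 0]
  proof eventually_elim
    case (elim m)
    have "1 - \<eta> \<le> real (block_exponent \<alpha> m)"
      using block_exponent_bounds(1)[OF elim] assms by linarith
    then show ?case using elim by (simp add: True)
  qed
next
  case False
  then have "\<alpha> / (2 - \<alpha>) > 0" using \<alpha> by simp
  then have "filterlim (\<lambda>m. real m powr (\<alpha> / (2 - \<alpha>))) at_top at_top"
    by real_asymp
  then have "eventually (\<lambda>m. real m powr (\<alpha> / (2 - \<alpha>)) \<ge> 1 / \<eta>) at_top"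
    by (simp add: filterlim_at_top)
  then show ?thesis
  proof eventually_elim
    case (elim m)
    then have "1 \<le> \<eta> * real m powr (\<alpha> / (2 - \<alpha>))" using assms by (simp add: field_simps)
    moreover have "real (block_exponent \<alpha> m) \<ge> real m powr (\<alpha> / (2 - \<alpha>)) - 1"
      unfolding block_exponent_def by linarith
    ultimately show ?case by (simp add: algebra_simps)
  qed
qed

text \<open>
  Without rounding there would be equality with \<open>m\<close>, as \<open>1 + \<alpha> / (2 - \<alpha>)\<close> and \<open>1 - \<alpha> / 2\<close> are
  reciprocal. The rounding factor only improves when raised to a power \<open>1 - \<alpha> / 2 \<le> 1\<close>.
\<close>

lemma block_powr_ge:
  assumes "m > 0" "0 < \<eta>" "\<eta> < 1" "real (block_exponent \<alpha> m) \<ge> (1 - \<eta>) * real m powr (\<alpha> / (2 - \<alpha>))"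
  shows "(real m * real (block_exponent \<alpha> m)) powr (1 - \<alpha> / 2) \<ge> (1 - \<eta>) * real m"
proof -
  have "(1 - \<eta>) powr 1 \<le> (1 - \<eta>) powr (1 - \<alpha> / 2)"
    using assms \<alpha> by (intro powr_mono') auto
  then have "(1 - \<eta>) * real m \<le> (1 - \<eta>) powr (1 - \<alpha> / 2) * real m"
    using assms by (intro mult_right_mono) auto
  also have "(1 - \<eta>) powr (1 - \<alpha> / 2) * real m
      = (1 - \<eta>) powr (1 - \<alpha> / 2) * (real m powr (1 + \<alpha> / (2 - \<alpha>))) powr (1 - \<alpha> / 2)"
  proof -
    have "(1 + \<alpha> / (2 - \<alpha>)) * (1 - \<alpha> / 2) = 1" using \<alpha> by (simp add: field_simps)
    then have "(real m powr (1 + \<alpha> / (2 - \<alpha>))) powr (1 - \<alpha> / 2) = real m powr 1"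
      by (simp only: powr_powr)
    then show ?thesis by simp
  qed
  also have "\<dots> = (real m * ((1 - \<eta>) * real m powr (\<alpha> / (2 - \<alpha>)))) powr (1 - \<alpha> / 2)"
    using assms by (simp add: powr_add powr_mult)
  also have "\<dots> \<le> (real m * real (block_exponent \<alpha> m)) powr (1 - \<alpha> / 2)"
    using assms \<alpha> by (intro powr_mono2 mult_left_mono) auto
  finally show ?thesis .
qed

text \<open>
  The linear term \<open>3 * k + 1 \<le> 4 * k\<close> of the binomial count is absorbed by
  \<open>n powr (\<alpha> / 2) * ln n\<close> because \<open>ln n \<ge> 1 / 2\<close>; hence the constant \<open>8\<close>, for every \<open>\<alpha>\<close>.
\<close>

lemma nonzero_digits_block_power:
  assumes "m > 0"
  defines "N \<equiv> (2 ^ m + 1) ^ block_exponent \<alpha> m"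
  shows "real (nonzero_digits N) \<le> 1 / (2 * ln 2) * real (binary_length N) powr \<alpha>
           + 8 * (real (binary_length N) powr (\<alpha> / 2) * ln (real (binary_length N)))"
proof -
  define k where "k = block_exponent \<alpha> m"
  define n where "n = real (binary_length N)"
  have k: "k \<ge> 1" using block_exponent_bounds[OF assms(1)] by (simp add: k_def)
  have "(2::nat) ^ (m * k) \<le> N"
    unfolding N_def k_def power_mult by (intro power_mono) auto
  then have "binary_length N \<ge> m * k + 1"
    unfolding binary_length_def by (intro floorlog_geI) auto
  then have "real (m * k + 1) \<le> n" unfolding n_def of_nat_le_iff .
  then have n: "n \<ge> real m * real k + 1" by (simp add: add.commute)
  have mk: "real m * real k \<ge> 1"
    using k assms(1) mult_mono[of 1 "real m" 1 "real k"] by simp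
  have "real k \<le> (real m * real k) powr (\<alpha> / 2)"
    using block_exponent_le_powr[OF assms(1)] by (simp add: k_def)
  also have "\<dots> \<le> n powr (\<alpha> / 2)" using n mk \<alpha> by (intro powr_mono2) auto
  finally have kn: "real k \<le> n powr (\<alpha> / 2)" .
  have "(real k)\<^sup>2 \<le> (n powr (\<alpha> / 2))\<^sup>2" using kn by (intro power_mono) auto
  also have "\<dots> = n powr \<alpha>" using n mk by (simp add: powr_power)
  finally have k2: "(real k)\<^sup>2 \<le> n powr \<alpha>" .
  have "ln 2 \<ge> (1 / 2 :: real)"
    using ln_le_minus_one[of "1 / 2 :: real"] by (simp add: ln_div)
  moreover have "ln n \<ge> ln 2" using n mk by (intro ln_mono) auto
  ultimately have lnn: "1 / 2 \<le> ln n" by linarith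
  have "real (nonzero_digits N) \<le> (real k)\<^sup>2 / (2 * ln 2) + 3 * real k + 1"
    unfolding N_def k_def by (rule nonzero_digits_binomial_power)
  also have "\<dots> \<le> n powr \<alpha> / (2 * ln 2) + 8 * (n powr (\<alpha> / 2) * (1 / 2))"
    using divide_right_mono[OF k2, of "2 * ln 2"] kn k by simp
  also have "\<dots> \<le> n powr \<alpha> / (2 * ln 2) + 8 * (n powr (\<alpha> / 2) * ln n)"
    using lnn by (intro add_left_mono mult_left_mono) auto
  finally show ?thesis by (simp add: n_def)
qed

text \<open>
  Since \<open>ln N\<close> is at least \<open>m * k * ln 2\<close>, the powers of \<open>ln 2\<close> combine to \<open>ln 2\<close> and those of \<open>m * k\<close>
  to almost \<open>m\<close>. In the other direction \<open>ln N \<le> 2 * m\<^sup>2\<close> and \<open>ln m \<le> x * ln x\<close>, so the triple logarithm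
  of \<open>N\<close> is at most about \<open>ln x\<close>.
\<close>

lemma ln_smoothness_level_ge:
  fixes x :: nat
  assumes m: "real m \<ge> 6" "ln (real m) \<le> real x * ln (real x)"
    and \<eta>: "0 < \<eta>" "\<eta> < 1" "real (block_exponent \<alpha> m) \<ge> (1 - \<eta>) * real m powr (\<alpha> / (2 - \<alpha>))"
    and x: "x \<ge> 3" "ln (3 * (real x * ln (real x))) \<le> (1 + \<eta>) * ln (real x)"
  defines "N \<equiv> (2 ^ m + 1) ^ block_exponent \<alpha> m"
  shows "ln (smoothness_level \<alpha> N) \<ge>
           2 * exp (- euler_mascheroni) * ln 2 * ((1 - \<eta>) * real m) / ((1 + \<eta>) * ln (real x))"
proof -
  define k where "k = block_exponent \<alpha> m"
  have m0: "m > 0" using m by simp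
  have k: "k \<ge> 1" "k \<le> m" using block_exponent_bounds[OF m0] by (simp_all add: k_def)
  have lnN: "ln (real N) = real k * ln (2 ^ m + 1)"
    unfolding N_def by (simp add: ln_realpow add_pos_pos k_def)
  have ln2: "1 / 2 \<le> ln (2::real)" "ln 2 \<le> (1::real)"
    using ln_le_minus_one[of "1 / 2 :: real"] ln_le_minus_one[of "2 :: real"] by (simp_all add: ln_div)
  have "real m * ln 2 \<le> ln (2 ^ m + 1)"
    by (subst ln_realpow[symmetric]) (auto intro!: ln_mono)
  then have lower: "real m * real k * ln 2 \<le> ln (real N)"
    unfolding lnN using mult_left_mono[of _ _ "real k"] by (fastforce simp: mult_ac)
  have "(2::real) ^ m + 1 \<le> 2 ^ m * 2 ^ m"
  proof -
    have "(2::real) \<le> 2 ^ m" using m0 power_increasing[of 1 m "2::real"] by simp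
    from mult_right_mono[OF this, of "2 ^ m"] this show ?thesis by linarith
  qed
  then have "ln ((2::real) ^ m + 1) \<le> ln (2 ^ m * 2 ^ m)"
    by (intro ln_mono) (auto simp: add_pos_pos)
  also have "\<dots> = 2 * real m * ln 2" by (simp add: ln_mult ln_realpow)
  also have "\<dots> \<le> 2 * real m" using ln2 mult_left_mono[of "ln 2" 1 "2 * real m"] by simp
  finally have "ln (real N) \<le> real m * (2 * real m)"
    unfolding lnN using k by (intro mult_mono) auto
  then have up1: "ln (real N) \<le> 2 * real m ^ 2" by (simp add: power2_eq_square)
  have "real m * real k * ln 2 \<ge> 6 * 1 * (1 / 2)"
    using m k ln2 by (intro mult_mono) auto
  then have low1: "ln (real N) \<ge> 3" using lower by simp
  define L where "L = ln (ln (ln (real N)))"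
  have "ln 3 \<le> ln (ln (real N))" using low1 by (intro ln_mono) auto
  then have lnln: "ln (ln (real N)) > 1" using ln3_gt_1 by linarith
  then have L0: "L > 0" by (simp add: L_def)
  have "ln (ln (real N)) \<le> ln (2 * real m ^ 2)" using up1 low1 by (intro ln_mono) auto
  also have "\<dots> = ln 2 + 2 * ln (real m)" using m0 by (simp add: ln_mult ln_realpow)
  also have "ln 2 \<le> ln (real m)" using m by (intro ln_mono) auto
  finally have "ln (ln (real N)) \<le> 3 * (real x * ln (real x))" using m(2) by simp
  then have "L \<le> ln (3 * (real x * ln (real x)))" unfolding L_def
    using lnln by (intro ln_mono) auto
  with x have L1: "L \<le> (1 + \<eta>) * ln (real x)" by linarith
  have "(1 - \<eta>) * real m * ln 2 \<le> (real m * real k) powr (1 - \<alpha> / 2) * ln 2"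
    using block_powr_ge[OF m0 \<eta>] ln2 by (intro mult_right_mono) (auto simp: k_def)
  also have "\<dots> = (real m * real k) powr (1 - \<alpha> / 2) * (ln 2 powr (\<alpha> / 2) * ln 2 powr (1 - \<alpha> / 2))"
    using ln2 by (simp flip: powr_add)
  also have "\<dots> = ln 2 powr (\<alpha> / 2) * (real m * real k * ln 2) powr (1 - \<alpha> / 2)"
    by (simp add: powr_mult)
  also have "\<dots> \<le> ln 2 powr (\<alpha> / 2) * ln (real N) powr (1 - \<alpha> / 2)"
    using lower \<alpha> ln2(1) by (intro mult_left_mono powr_mono2 mult_nonneg_nonneg) simp_all
  finally have main: "(1 - \<eta>) * real m * ln 2 \<le> ln 2 powr (\<alpha> / 2) * ln (real N) powr (1 - \<alpha> / 2)" .
  have "2 * exp (- euler_mascheroni) * ln 2 * ((1 - \<eta>) * real m) / ((1 + \<eta>) * ln (real x))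
      = 2 * exp (- euler_mascheroni) * ((1 - \<eta>) * real m * ln 2) / ((1 + \<eta>) * ln (real x))"
    by (simp only: mult.assoc mult.commute mult.left_commute)
  also have "\<dots> \<le> 2 * exp (- euler_mascheroni) * (ln 2 powr (\<alpha> / 2) * ln (real N) powr (1 - \<alpha> / 2)) / L"
  proof (rule frac_le)
    show "2 * exp (- euler_mascheroni) * ((1 - \<eta>) * real m * ln 2)
        \<le> 2 * exp (- euler_mascheroni) * (ln 2 powr (\<alpha> / 2) * ln (real N) powr (1 - \<alpha> / 2))"
      using main by (rule mult_left_mono) simp
  qed (use L0 L1 in simp_all)
  also have "\<dots> = ln (smoothness_level \<alpha> N)"
    unfolding smoothness_level_def L_def divide_inverse ln_exp by (simp only: mult.assoc)
  finally show ?thesis .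
qed

text \<open>
  The Mertens bound at a suitable \<open>x\<close> turns the totient in the estimate of the prime divisors into
  \<open>2 * m * exp (t - euler_mascheroni) / ln x\<close>; comparing with the lower bound for the smoothness level
  leaves the factor \<open>(1 + t)\<^sup>2 * exp t / (1 - t)\<close>, which is below \<open>1 + \<eta>\<close> for small \<open>t\<close>.
\<close>

lemma sparse_smooth_number_exists:
  assumes "\<eta> > 0"
  shows "\<exists>N\<ge>N0. smooth (smoothness_level \<alpha> N powr (1 + \<eta>)) N \<and>
           real (nonzero_digits N) \<le> 1 / (2 * ln 2) * real (binary_length N) powr \<alpha>
             + 8 * (real (binary_length N) powr (\<alpha> / 2) * ln (real (binary_length N)))"
proof -
  have "((\<lambda>t::real. (1 + t) * (1 + t) * exp t - (1 + \<eta>) * (1 - t)) \<longlongrightarrow> - \<eta>) (at_right 0)"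
    by real_asymp
  then have "eventually (\<lambda>t::real. (1 + t) * (1 + t) * exp t - (1 + \<eta>) * (1 - t) < 0) (at_right 0)"
    using assms by (intro order_tendstoD) auto
  moreover have "eventually (\<lambda>t::real. 0 < t \<and> t < 1) (at_right 0)"
    by (auto simp: eventually_at_right_field intro!: exI[of _ 1])
  ultimately have "eventually (\<lambda>t::real. 0 < t \<and> t < 1 \<and>
      (1 + t) * (1 + t) * exp t - (1 + \<eta>) * (1 - t) < 0) (at_right 0)"
    by eventually_elim auto
  then obtain t :: real where t: "0 < t" "t < 1" "(1 + t) * (1 + t) * exp t < (1 + \<eta>) * (1 - t)"
    using eventually_happens'[of "at_right (0::real)"] by auto
  obtain m1 where m1: "\<And>m. m \<ge> m1 \<Longrightarrow> real (block_exponent \<alpha> m) \<ge> (1 - t) * real m powr (\<alpha> / (2 - \<alpha>))"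
    using block_exponent_asymp[OF t(1)] by (auto simp: eventually_at_top_linorder)
  have "eventually (\<lambda>x. ln (3 * (real x * ln (real x))) \<le> (1 + t) * ln (real x)) at_top"
    using t(1) by real_asymp
  then obtain x1 where x1: "\<And>x. x \<ge> x1 \<Longrightarrow> ln (3 * (real x * ln (real x))) \<le> (1 + t) * ln (real x)"
    by (auto simp: eventually_at_top_linorder)
  \<comment> \<open>A single large prime \<open>q \<le> x\<close> makes \<open>m\<close> large and the error \<open>4 / (q - 1)\<close> small.\<close>
  obtain q where q: "prime q" "q > N0 + m1 + 6 + nat \<lceil>4 / t\<rceil>"
    using bigger_prime by blast
  have "odd q" using q primes_dvd_imp_eq[of 2 q] by auto
  have "4 / t \<le> real q - 1" using q(2) by linarith
  then have qt: "4 / (real q - 1) \<le> t" using t(1) q(2) by (simp add: field_simps)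
  obtain x where x: "x \<ge> x1 + q + 3"
    "(\<Prod>p | prime p \<and> p \<le> x. 1 - 1 / real p) < exp (- euler_mascheroni + t) / ln (real x)"
    using Mertens_product_infinitely_often[OF t(1), of "x1 + q + 3"] by blast
  have qx: "q \<le> x" and x3: "x \<ge> 3" using x by auto
  define m where "m = odd_primorial x"
  have m: "m \<ge> q" unfolding m_def using q(1) \<open>odd q\<close> qx by (rule prime_le_odd_primorial)
  then have m0: "m > 0" using q(2) by simp
  define N :: nat where "N = (2 ^ m + 1) ^ block_exponent \<alpha> m"
  have "N \<ge> (2 ^ m + 1) ^ 1"
    unfolding N_def using block_exponent_bounds(1)[OF m0] by (intro power_increasing) auto
  then have "2 ^ m + 1 \<le> N" by (simp only: power_one_right)
  then have "N \<ge> m" using less_exp[of m] by linarith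
  then have N0: "N \<ge> N0" "N > 0" using m q(2) by auto
  define Y where "Y = smoothness_level \<alpha> N"
  have lnY: "ln Y \<ge> 2 * exp (- euler_mascheroni) * ln 2 * ((1 - t) * real m) / ((1 + t) * ln (real x))"
    unfolding Y_def N_def
  proof (rule ln_smoothness_level_ge)
    show "real m \<ge> 6" using m q(2) by simp
    show "ln (real m) \<le> real x * ln (real x)" unfolding m_def by (rule ln_odd_primorial_le)
    show "ln (3 * (real x * ln (real x))) \<le> (1 + t) * ln (real x)" using x by (intro x1) auto
  qed (use t x3 m q(2) in \<open>auto intro: m1\<close>)
  have lnx: "ln (real x) > 0" using x3 by simp
  have "real p \<le> Y powr (1 + \<eta>)" if p: "prime p" "p dvd N" for p
  proof -
    have "ln (real p) \<le> ln 2 * ((1 + 4 / (real q - 1)) *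
            (2 * real m * (\<Prod>p | prime p \<and> p \<le> x. 1 - 1 / real p)))"
      unfolding m_def by (rule ln_prime_divisor_le) (use q \<open>odd q\<close> qx p in \<open>auto simp: N_def m_def\<close>)
    also have "\<dots> \<le> ln 2 * ((1 + t) * (2 * real m * (exp (- euler_mascheroni + t) / ln (real x))))"
      using qt x(2) t by (intro mult_left_mono mult_mono) (auto intro!: mult_nonneg_nonneg prod_nonneg dest: prime_gt_0_nat)
    also have "\<dots> = (2 * exp (- euler_mascheroni) * ln 2 * real m / ((1 + t) * ln (real x))) * ((1 + t) * (1 + t) * exp t)"
    proof -
      have "a * (s * (2 * M * (E * F / l))) = (2 * E * a * M / (s * l)) * (s * s * F)"
        if "s \<noteq> 0" "l \<noteq> 0" for a s M E F l :: real
        using that by (simp add: divide_simps)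
      then show ?thesis unfolding exp_add using t lnx by simp
    qed
    also have "\<dots> \<le> (2 * exp (- euler_mascheroni) * ln 2 * real m / ((1 + t) * ln (real x))) * ((1 + \<eta>) * (1 - t))"
      using t lnx by (intro mult_left_mono) auto
    also have "\<dots> = (1 + \<eta>) * (2 * exp (- euler_mascheroni) * ln 2 * ((1 - t) * real m) / ((1 + t) * ln (real x)))"
      by (simp add: mult_ac)
    also have "\<dots> \<le> (1 + \<eta>) * ln Y"
      using lnY assms by (intro mult_left_mono) auto
    finally have "exp (ln (real p)) \<le> exp ((1 + \<eta>) * ln Y)" by simp
    moreover have "Y > 0" by (simp add: Y_def smoothness_level_def)
    ultimately show ?thesis using prime_gt_0_nat[OF p(1)] by (simp add: powr_def)
  qed
  then have "smooth (Y powr (1 + \<eta>)) N"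
    unfolding smooth_def using N0(2) by (meson not_less)
  then show ?thesis
    using nonzero_digits_block_power[OF m0] N0(1) unfolding Y_def N_def by blast
qed

end

section \<open>Passage to an infinite set\<close>

text \<open>
  Choose a strictly increasing sequence whose \<open>j\<close>-th element satisfies \<open>P (1 / (j + 1))\<close>; its
  injectivity lets the error be read off from the element.
\<close>

lemma infinite_set_with_vanishing_error:
  fixes P :: "real \<Rightarrow> nat \<Rightarrow> bool"
  assumes "\<And>\<eta> N0. \<eta> > 0 \<Longrightarrow> \<exists>N\<ge>N0. P \<eta> N"
  obtains S \<epsilon> where "infinite S" "(\<epsilon> \<longlongrightarrow> 0) (inf at_top (principal S))" "\<And>N. N \<in> S \<Longrightarrow> P (\<epsilon> N) N"
proof -
  have ex: "\<exists>N>N0. P (1 / real (Suc j)) N" for N0 j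
    using assms[of "1 / real (Suc j)" "Suc N0"] by (auto simp: Suc_le_eq)
  obtain f where f: "\<And>j. P (1 / real (Suc j)) (f j)" "\<And>j. f j < f (Suc j)"
    using dependent_nat_choice[of "\<lambda>j N. P (1 / real (Suc j)) N" "\<lambda>_ M N. M < N"] ex by metis
  have mono: "strict_mono f" using f(2) by (simp add: strict_mono_Suc_iff)
  then have inj: "inj f" by (rule strict_mono_imp_inj_on)
  define \<epsilon> where "\<epsilon> N = 1 / real (Suc (inv_into UNIV f N))" for N
  have "(\<epsilon> \<longlongrightarrow> 0) (inf at_top (principal (range f)))"
  proof (rule tendstoI)
    fix e :: real assume "e > 0"
    then obtain J where J: "1 / real (Suc J) < e"
      using reals_Archimedean[of e] by (auto simp: inverse_eq_divide)
    have "dist (\<epsilon> N) 0 < e" if N: "N \<ge> f J" "N \<in> range f" for N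
    proof -
      obtain j where j: "N = f j" using N(2) by (rule rangeE)
      have "J \<le> j" using N(1) mono unfolding j by (simp add: strict_mono_less_eq)
      then have "1 / real (Suc j) \<le> 1 / real (Suc J)" by (intro divide_left_mono) auto
      then show ?thesis using J inj by (simp add: \<epsilon>_def j del: of_nat_Suc)
    qed
    then show "eventually (\<lambda>N. dist (\<epsilon> N) 0 < e) (inf at_top (principal (range f)))"
      unfolding eventually_inf_principal eventually_at_top_linorder by blast
  qed
  moreover have "infinite (range f)" using inj by (rule range_inj_infinite)
  moreover have "P (\<epsilon> N) N" if "N \<in> range f" for N
    using that f(1) inj by (auto simp: \<epsilon>_def)
  ultimately show ?thesis using that by blast
qed

theorem theorem1p3:
  shows "\<exists>c>0. \<forall>\<alpha>::real. 0 \<le> \<alpha> \<and> \<alpha> \<le> 1 \<longrightarrow>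
    (\<exists>(S :: nat set) (\<epsilon> :: nat \<Rightarrow> real).
       infinite S \<and>
       (\<epsilon> \<longlongrightarrow> 0) (inf at_top (principal S)) \<and>
       (\<forall>N\<in>S. N \<ge> 1 \<and>
          smooth (smoothness_level \<alpha> N powr (1 + \<epsilon> N)) N \<and>
          (let n = real (binary_length N) in
             real (nonzero_digits N)
               \<le> 1 / (2 * ln 2) * n powr \<alpha> + c * (n powr (\<alpha> / 2) * ln n))))"
proof (intro exI[of _ "8::real"] conjI allI impI)
  fix \<alpha> :: real assume "0 \<le> \<alpha> \<and> \<alpha> \<le> 1"
  then have \<alpha>: "0 \<le> \<alpha>" "\<alpha> \<le> 1" by auto
  define P where "P = (\<lambda>\<eta> N. smooth (smoothness_level \<alpha> N powr (1 + \<eta>)) N \<and>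
           real (nonzero_digits N) \<le> 1 / (2 * ln 2) * real (binary_length N) powr \<alpha>
             + 8 * (real (binary_length N) powr (\<alpha> / 2) * ln (real (binary_length N))))"
  have "\<exists>N\<ge>N0. P \<eta> N" if "\<eta> > 0" for \<eta> N0
    unfolding P_def using sparse_smooth_number_exists[OF \<alpha> that] .
  then obtain S \<epsilon> where S: "infinite S" "(\<epsilon> \<longlongrightarrow> 0) (inf at_top (principal S))"
      and PS: "\<And>N. N \<in> S \<Longrightarrow> P (\<epsilon> N) N"
    using infinite_set_with_vanishing_error[of P] by blast
  have "N \<ge> 1" if "N \<in> S" for N
    using PS[OF that] by (simp add: P_def smooth_def)
  with S PS show "\<exists>(S :: nat set) (\<epsilon> :: nat \<Rightarrow> real). infinite S \<and>
       (\<epsilon> \<longlongrightarrow> 0) (inf at_top (principal S)) \<and>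
       (\<forall>N\<in>S. N \<ge> 1 \<and>
          smooth (smoothness_level \<alpha> N powr (1 + \<epsilon> N)) N \<and>
          (let n = real (binary_length N) in
             real (nonzero_digits N)
               \<le> 1 / (2 * ln 2) * n powr \<alpha> + 8 * (n powr (\<alpha> / 2) * ln n)))"
    unfolding P_def Let_def by blast
qed simp

end
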